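(* Let $\mathrm{U}_{k,n}^-$ be an almost-uniform matroid of rank $k$ on a ground set $E$ of size $n$ with $k<n$. Then $$\widehat{\alpha}(I(\mathrm{U}_{k,n}^-))= \min\left\{\frac{n-1}{n-k},\frac{n+1}{n-k+1}\right\}= \begin{cases} \dfrac{n-1}{n-k} & \text{ if } 2k\le n+1,\\[6pt] \dfrac{n+1}{n-k+1} & \text{ if } 2k \ge n+1. \end{cases}$$
   Context: Let $\mathbb{K}$ be a field, $S=\mathbb{K}[x_e : e\in E]$ the standard graded polynomial ring, and $x^U=\prod_{i\in U}x_i$ for $U\subseteq E$. For a squarefree monomial ideal $I\subseteq S$ and $s\ge 1$, the $s$-th symbolic power is $I^{(s)}=\bigcap_{P\in \mathrm{Min}(I)}P^s$, where $\mathrm{Min}(I)$ is the set of minimal primes of $I$. For a nonzero homogeneous ideal $I$, $\alpha(I)$ is the smallest degree of a nonzero homogeneous element of $I$; the Waldschmidt constant is $\widehat{\alpha}(I)=\lim_{s\to\infty}\alpha(I^{(s)})/s$. For a matroid $M$ on $E$ with set of bases $\mathcal{B}(M)$, the facet ideal is $I(M)=\langle x^B : B\in\mathcal{B}(M)\rangle$. An almost-uniform matroid $\mathrm{U}^-_{k,n}$ of rank $k$ on a set $E$ of size $n$ is a matroid whose set of bases consists of all $k$-element subsets of $E$ except exactly one. *)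

theory Defs
  imports
    Complex_Main
    "HOL-Library.Poly_Mapping"
    "HOL-Algebra.Ideal_Product"
    "HOL-Algebra.Algebraic_Closure_Type"
begin

text \<open>
  Polynomials with coefficients in \<open>'k\<close> and variables indexed by \<open>'e\<close>: finitely supported maps
  from exponent vectors to coefficients. The variables that actually occur are
  restricted to a ground set \<open>E\<close> by choosing the carrier of the ring accordingly.
\<close>

type_synonym ('e, 'k) mpoly = "('e \<Rightarrow>\<^sub>0 nat) \<Rightarrow>\<^sub>0 'k"

definition mpoly_ring :: "'e set \<Rightarrow> ('e, 'k::field) mpoly ring" where
  "mpoly_ring E =
     ring_of_type_algebra\<lparr>carrier := {p. \<forall>m \<in> Poly_Mapping.keys p. Poly_Mapping.keys m \<subseteq> E}\<rparr>"

definition var :: "'e \<Rightarrow> ('e, 'k::field) mpoly" where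
  "var e = Poly_Mapping.single (Poly_Mapping.single e 1) 1"

definition sqfree_monom :: "'e set \<Rightarrow> ('e, 'k::field) mpoly" where
  "sqfree_monom U = (\<Prod>i\<in>U. var i)"

definition monom_degree :: "('e \<Rightarrow>\<^sub>0 nat) \<Rightarrow> nat" where
  "monom_degree m = (\<Sum>e \<in> Poly_Mapping.keys m. Poly_Mapping.lookup m e)"

definition homogeneous :: "nat \<Rightarrow> ('e, 'k::field) mpoly \<Rightarrow> bool" where
  "homogeneous d p \<longleftrightarrow> (\<forall>m \<in> Poly_Mapping.keys p. monom_degree m = d)"

definition minimal_primes :: "('a, 'b) ring_scheme \<Rightarrow> 'a set \<Rightarrow> 'a set set" where
  "minimal_primes R I =
     {P. primeideal P R \<and> I \<subseteq> P \<and> (\<forall>Q. primeideal Q R \<and> I \<subseteq> Q \<and> Q \<subseteq> P \<longrightarrow> Q = P)}"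

text \<open>
  The power \<open>P\<^sup>s\<close> is taken in the multiplicative monoid of ideals of \<open>R\<close>; the intersection is
  formed inside \<open>R\<close>, which only matters when there are no minimal primes.
\<close>

definition symbolic_power :: "('a, 'b) ring_scheme \<Rightarrow> 'a set \<Rightarrow> nat \<Rightarrow> 'a set" where
  "symbolic_power R I s =
     carrier R \<inter> (\<Inter>P \<in> minimal_primes R I. P [^]\<^bsub>ideals_set R\<^esub> s)"

definition alpha :: "('e, 'k::field) mpoly set \<Rightarrow> nat" where
  "alpha I = (LEAST d. \<exists>p \<in> I. p \<noteq> 0 \<and> homogeneous d p)"

definition waldschmidt_seq :: "'e set \<Rightarrow> ('e, 'k::field) mpoly set \<Rightarrow> nat \<Rightarrow> real" where
  "waldschmidt_seq E I s = real (alpha (symbolic_power (mpoly_ring E) I s)) / real s"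

definition waldschmidt :: "'e set \<Rightarrow> ('e, 'k::field) mpoly set \<Rightarrow> real" where
  "waldschmidt E I = lim (waldschmidt_seq E I)"

text \<open>A matroid on a finite ground set, given by its set of bases.\<close>

definition matroid_bases :: "'e set \<Rightarrow> 'e set set \<Rightarrow> bool" where
  "matroid_bases E \<B> \<longleftrightarrow>
     finite E \<and> \<B> \<subseteq> Pow E \<and> \<B> \<noteq> {} \<and>
     (\<forall>A \<in> \<B>. \<forall>B \<in> \<B>. \<forall>x \<in> A - B. \<exists>y \<in> B - A. insert y (A - {x}) \<in> \<B>)"

definition almost_uniform :: "'e set \<Rightarrow> nat \<Rightarrow> 'e set set \<Rightarrow> bool" where
  "almost_uniform E k \<B> \<longleftrightarrow>
     matroid_bases E \<B> \<and>
     (\<exists>C \<in> {B. B \<subseteq> E \<and> card B = k}. \<B> = {B. B \<subseteq> E \<and> card B = k} - {C})"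

definition facet_ideal :: "'e set \<Rightarrow> 'e set set \<Rightarrow> ('e, 'k::field) mpoly set" where
  "facet_ideal E \<B> = Idl\<^bsub>mpoly_ring E\<^esub> (sqfree_monom ` \<B>)"

end

theory Submission
  imports Defs
begin

text \<open>
  For a set \<open>F\<close> containing no basis and maximal with this property, the variables outside \<open>F\<close>
  generate a minimal prime of \<open>I\<close>, and every prime containing \<open>I\<close> contains the variables outside
  some basis-free set. Hence \<open>\<alpha>(I\<^sup>(\<^sup>s\<^sup>))\<close> is the minimum of \<open>\<Sum>e\<in>E. m e\<close> over \<open>m :: E \<Rightarrow> \<nat>\<close> with
  \<open>(\<Sum>e\<in>E - F. m e) \<ge> s\<close> for all basis-free \<open>F\<close>. If \<open>C\<close> is the omitted \<open>k\<close>-set, the basis-free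
  sets are \<open>C\<close> and the sets of size less than \<open>k\<close>, so with \<open>d = n - k\<close> the constraints concern
  \<open>E - C\<close> and all sets of size \<open>d + 1\<close>. The fractional optimum is attained by a function that is
  constant on \<open>C\<close> and on \<open>E - C\<close>; averaging over sets of size \<open>d + 1\<close> that lie inside \<open>C\<close>
  (if \<open>k \<ge> d + 1\<close>) or contain \<open>C\<close> (otherwise) gives the matching lower bound. Rounding up \<open>s\<close> times
  the optimum costs at most \<open>n\<close>, which vanishes in the limit.
\<close>

section \<open>Ideals of polynomials of large order\<close>

lemma finite_maximizer:
  fixes f :: "'a \<Rightarrow> 'b::linorder"
  assumes "finite S" "S \<noteq> {}"
  obtains a where "a \<in> S" "\<And>b. b \<in> S \<Longrightarrow> f b \<le> f a"
proof -
  have "Max (f ` S) \<in> f ` S" using assms by simp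
  then obtain a where a: "a \<in> S" "Max (f ` S) = f a" by blast
  have "f b \<le> f a" if "b \<in> S" for b
    using that assms(1) Max_ge[of "f ` S" "f b"] unfolding a(2)[symmetric] by simp
  with a(1) show ?thesis by (rule that)
qed

section \<open>The polynomial ring with variables restricted to a ground set\<close>

lemma mpoly_ring_simps [simp]:
  "carrier (mpoly_ring E) = {p. \<forall>m \<in> Poly_Mapping.keys p. Poly_Mapping.keys m \<subseteq> E}"
  "monoid.mult (mpoly_ring E) = (*)"
  "monoid.one (mpoly_ring E) = 1"
  "ring.zero (mpoly_ring E) = 0"
  "ring.add (mpoly_ring E) = (+)"
  by (simp_all add: mpoly_ring_def ring_of_type_algebra_def)

lemma keys_add_nat:
  "Poly_Mapping.keys (a + b) = Poly_Mapping.keys a \<union> Poly_Mapping.keys (b :: 'e \<Rightarrow>\<^sub>0 nat)"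
  by (auto simp: in_keys_iff lookup_add)

lemma keys_uminus [simp]:
  "Poly_Mapping.keys (- p) = Poly_Mapping.keys (p :: 'a \<Rightarrow>\<^sub>0 'b::ab_group_add)"
  by (auto simp: in_keys_iff)

lemma keys_multE:
  assumes "m \<in> Poly_Mapping.keys (p * q)"
  obtains a b where "a \<in> Poly_Mapping.keys p" "b \<in> Poly_Mapping.keys q" "m = a + b"
  using assms keys_mult[of p q] by blast

lemma keys_plusE:
  assumes "m \<in> Poly_Mapping.keys (p + q)"
  obtains "m \<in> Poly_Mapping.keys p" | "m \<in> Poly_Mapping.keys q"
  using assms keys_add[of p q] by blast

lemma sum_single_lookup:
  "(\<Sum>m\<in>Poly_Mapping.keys p. Poly_Mapping.single m (Poly_Mapping.lookup p m)) = p"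
  by (rule poly_mapping_eqI) (auto simp: lookup_sum lookup_single when_def in_keys_iff)

lemma mpoly_ring_cring: "cring (mpoly_ring E :: ('e, 'k::field) mpoly ring)"
proof (intro cringI abelian_groupI comm_monoidI; (simp add: algebra_simps)?)
  fix p q :: "('e, 'k) mpoly"
  assume pq: "\<forall>m\<in>Poly_Mapping.keys p. Poly_Mapping.keys m \<subseteq> E"
    "\<forall>m\<in>Poly_Mapping.keys q. Poly_Mapping.keys m \<subseteq> E"
  show "\<forall>m\<in>Poly_Mapping.keys (p + q). Poly_Mapping.keys m \<subseteq> E"
    using pq by (metis keys_plusE)
  show "\<forall>m\<in>Poly_Mapping.keys (p * q). Poly_Mapping.keys m \<subseteq> E"
    using pq by (metis keys_multE keys_add_nat Un_least)
next
  fix p :: "('e, 'k) mpoly"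
  assume "\<forall>m\<in>Poly_Mapping.keys p. Poly_Mapping.keys m \<subseteq> E"
  then show "\<exists>y. (\<forall>m\<in>Poly_Mapping.keys y. Poly_Mapping.keys m \<subseteq> E) \<and> p + y = 0"
    by (intro exI[of _ "- p"]) auto
qed

section \<open>Powers of variable ideals, described by exponents\<close>

definition partial_degree :: "'e set \<Rightarrow> ('e \<Rightarrow>\<^sub>0 nat) \<Rightarrow> nat" where
  "partial_degree D m = (\<Sum>e\<in>D. Poly_Mapping.lookup m e)"

lemma partial_degree_add: "partial_degree D (a + b) = partial_degree D a + partial_degree D b"
  by (simp add: partial_degree_def lookup_add sum.distrib)

lemma partial_degree_zero [simp]: "partial_degree D 0 = 0"
  by (simp add: partial_degree_def)

lemma partial_degree_single:
  "finite D \<Longrightarrow> partial_degree D (Poly_Mapping.single e (Suc 0)) = (if e \<in> D then 1 else 0)"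
  by (simp add: partial_degree_def lookup_single when_def)

text \<open>For finite \<open>D\<close> contained in \<open>E\<close> this is the
  \<open>s\<close>-th power of the prime generated by the variables in \<open>D\<close>. The
  description by exponents makes membership a test on single monomials.\<close>

definition order_ideal :: "'e set \<Rightarrow> 'e set \<Rightarrow> nat \<Rightarrow> ('e, 'k::field) mpoly set" where
  "order_ideal E D s =
     {p \<in> carrier (mpoly_ring E). \<forall>m\<in>Poly_Mapping.keys p. s \<le> partial_degree D m}"

lemma order_ideal_add: "p \<in> order_ideal E D s \<Longrightarrow> q \<in> order_ideal E D s \<Longrightarrow> p + q \<in> order_ideal E D s"
  unfolding order_ideal_def by (auto elim!: keys_plusE)

lemma order_ideal_mult:
  assumes "p \<in> order_ideal E D s" "q \<in> order_ideal E D t"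
  shows "p * q \<in> order_ideal E D (s + t)"
  using assms unfolding order_ideal_def
  by (fastforce elim!: keys_multE simp: partial_degree_add keys_add_nat intro: add_mono)

lemma order_ideal_0 [simp]: "order_ideal E D 0 = carrier (mpoly_ring E)"
  by (simp add: order_ideal_def)

lemma ideal_order_ideal: "ideal (order_ideal E D s :: ('e, 'k::field) mpoly set) (mpoly_ring E)"
proof -
  interpret cring "mpoly_ring E :: ('e, 'k) mpoly ring" by (rule mpoly_ring_cring)
  show ?thesis
  proof (rule idealI)
    show "ring (mpoly_ring E :: ('e, 'k) mpoly ring)" by (rule ring_axioms)
    have uminus: "\<ominus>\<^bsub>mpoly_ring E\<^esub> p = - p" if "p \<in> carrier (mpoly_ring E)" for p :: "('e, 'k) mpoly"
      using that by (intro minus_equality) auto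
    show "subgroup (order_ideal E D s) (add_monoid (mpoly_ring E :: ('e, 'k) mpoly ring))"
    proof (rule add.subgroupI)
      show "order_ideal E D s \<noteq> ({} :: ('e, 'k) mpoly set)"
        by (auto simp: order_ideal_def intro!: exI[of _ 0])
      fix p :: "('e, 'k) mpoly" assume "p \<in> order_ideal E D s"
      then show "\<ominus>\<^bsub>mpoly_ring E\<^esub> p \<in> order_ideal E D s"
        using uminus[of p] by (simp add: order_ideal_def)
    next
      show "order_ideal E D s \<subseteq> carrier (mpoly_ring E :: ('e, 'k) mpoly ring)"
        unfolding order_ideal_def by blast
    qed (simp add: order_ideal_add)
  next
    fix a x :: "('e, 'k) mpoly"
    assume "a \<in> order_ideal E D s" "x \<in> carrier (mpoly_ring E)"
    \<comment> \<open>Order \<open>0\<close> gives the whole carrier, so absorption is the product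
      rule with \<open>t = 0\<close>.\<close>
    then have "a * x \<in> order_ideal E D (s + 0)"
      by (intro order_ideal_mult) auto
    then show "x \<otimes>\<^bsub>mpoly_ring E\<^esub> a \<in> order_ideal E D s" "a \<otimes>\<^bsub>mpoly_ring E\<^esub> x \<in> order_ideal E D s"
      by (simp_all add: mult.commute)
  qed
qed

text \<open>The exponents come without a linear order, so the pair of leading monomials is chosen by
  maximising one exponent after another.\<close>

lemma unique_sum_exists:
  fixes K L :: "('e \<Rightarrow>\<^sub>0 nat) set"
  assumes "finite A" "finite K" "K \<noteq> {}" "finite L" "L \<noteq> {}"
    and "\<And>a b e. a \<in> K \<Longrightarrow> b \<in> K \<Longrightarrow> e \<notin> A \<Longrightarrow> Poly_Mapping.lookup a e = Poly_Mapping.lookup b e"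
    and "\<And>a b e. a \<in> L \<Longrightarrow> b \<in> L \<Longrightarrow> e \<notin> A \<Longrightarrow> Poly_Mapping.lookup a e = Poly_Mapping.lookup b e"
  shows "\<exists>a\<in>K. \<exists>b\<in>L. \<forall>a'\<in>K. \<forall>b'\<in>L. a' + b' = a + b \<longrightarrow> a' = a \<and> b' = b"
  using assms
proof (induction A arbitrary: K L rule: finite_induct)
  case empty
  have "a = b" if "a \<in> K \<and> b \<in> K \<or> a \<in> L \<and> b \<in> L" for a b
    by (rule poly_mapping_eqI) (use that empty.prems(5,6) in blast)
  with empty.prems(2,4) show ?case by blast
next
  case (insert x A)
  \<comment> \<open>Elements of \<open>top S\<close> agree in the exponent of \<open>x\<close> as
    well, so the induction hypothesis for \<open>A\<close> applies to \<open>top K\<close> and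
    \<open>top L\<close>.\<close>
  define top where "top S = {a \<in> S. \<forall>b\<in>S. Poly_Mapping.lookup b x \<le> Poly_Mapping.lookup a x}"
    for S :: "('e \<Rightarrow>\<^sub>0 nat) set"
  have top: "finite (top S)" "top S \<noteq> {}" if "finite S" "S \<noteq> {}" for S
  proof -
    obtain a where "a \<in> S" "\<And>b. b \<in> S \<Longrightarrow> Poly_Mapping.lookup b x \<le> Poly_Mapping.lookup a x"
      using finite_maximizer[of S "\<lambda>a. Poly_Mapping.lookup a x"] \<open>finite S\<close> \<open>S \<noteq> {}\<close> by blast
    then show "top S \<noteq> {}" by (auto simp: top_def)
  qed (use that in \<open>simp add: top_def\<close>)
  have agree: "Poly_Mapping.lookup a e = Poly_Mapping.lookup b e"
    if "a \<in> top S" "b \<in> top S" "e \<notin> A"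
      "\<And>a b e. a \<in> S \<Longrightarrow> b \<in> S \<Longrightarrow> e \<notin> insert x A \<Longrightarrow> Poly_Mapping.lookup a e = Poly_Mapping.lookup b e"
    for a b e S
  proof (cases "e = x")
    case True
    with that(1,2) show ?thesis by (auto simp: top_def intro: antisym)
  next
    case False
    with that(1-3) show ?thesis by (intro that(4)) (auto simp: top_def)
  qed
  have "\<exists>a\<in>top K. \<exists>b\<in>top L. \<forall>a'\<in>top K. \<forall>b'\<in>top L. a' + b' = a + b \<longrightarrow> a' = a \<and> b' = b"
  proof (rule insert.IH)
    show "Poly_Mapping.lookup a e = Poly_Mapping.lookup b e"
      if "a \<in> top K" "b \<in> top K" "e \<notin> A" for a b e
      using that insert.prems(5) by (rule agree)
    show "Poly_Mapping.lookup a e = Poly_Mapping.lookup b e"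
      if "a \<in> top L" "b \<in> top L" "e \<notin> A" for a b e
      using that insert.prems(6) by (rule agree)
  qed (use top insert.prems(1-4) in simp_all)
  then obtain a b where ab: "a \<in> top K" "b \<in> top L"
    and uniq: "\<And>a' b'. a' \<in> top K \<Longrightarrow> b' \<in> top L \<Longrightarrow> a' + b' = a + b \<Longrightarrow> a' = a \<and> b' = b"
    by blast
  \<comment> \<open>A competing pair with the same sum must also be maximal at \<open>x\<close>:
    neither exponent exceeds its maximum, and the two maxima already add up to the exponent of the
    sum.\<close>
  have "a' \<in> top K \<and> b' \<in> top L" if "a' \<in> K" "b' \<in> L" "a' + b' = a + b" for a' b'
  proof -
    have "Poly_Mapping.lookup a' x + Poly_Mapping.lookup b' x
        = Poly_Mapping.lookup a x + Poly_Mapping.lookup b x"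
      using that(3) by (metis lookup_add)
    moreover have "Poly_Mapping.lookup a' x \<le> Poly_Mapping.lookup a x"
      "Poly_Mapping.lookup b' x \<le> Poly_Mapping.lookup b x"
      using ab that by (auto simp: top_def)
    ultimately have "Poly_Mapping.lookup a' x = Poly_Mapping.lookup a x"
      "Poly_Mapping.lookup b' x = Poly_Mapping.lookup b x"
      by linarith+
    with that ab show ?thesis by (simp add: top_def)
  qed
  moreover have "a \<in> K" "b \<in> L" using ab by (auto simp: top_def)
  ultimately show ?case using uniq by blast
qed

text \<open>The coefficient of \<open>a + b\<close> is a sum over all decompositions of
  \<open>a + b\<close>; uniqueness leaves at most the term for \<open>(a, b)\<close>.\<close>

lemma lookup_mult_unique_sum:
  fixes p q :: "'a::monoid_add \<Rightarrow>\<^sub>0 'b::semiring_0"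
  assumes "\<And>a' b'. a' \<in> Poly_Mapping.keys p \<Longrightarrow> b' \<in> Poly_Mapping.keys q \<Longrightarrow>
    a' + b' = a + b \<Longrightarrow> a' = a \<and> b' = b"
  shows "Poly_Mapping.lookup (p * q) (a + b) = Poly_Mapping.lookup p a * Poly_Mapping.lookup q b"
proof -
  have "Poly_Mapping.lookup p l * Sum_any (\<lambda>r. Poly_Mapping.lookup q r when a + b = l + r)
      = (Poly_Mapping.lookup p a * Poly_Mapping.lookup q b when l = a)" for l
  proof (cases "l \<in> Poly_Mapping.keys p")
    case True
    have "(Poly_Mapping.lookup q r when a + b = l + r)
        = ((Poly_Mapping.lookup q b when l = a) when r = b)" for r
    proof (cases "r \<in> Poly_Mapping.keys q")
      case r: True
      show ?thesis using assms[OF True r] by (cases "a + b = l + r") (auto simp: when_def)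
    qed (auto simp: in_keys_iff when_def)
    then show ?thesis by (simp add: when_def)
  qed (auto simp: in_keys_iff when_def)
  then show ?thesis by (simp add: lookup_mult)
qed

text \<open>If neither factor lies in the ideal, both have monomials of partial degree 0. Among
  these, a pair whose sum arises in only one way gives the product a monomial of partial degree 0
  that cannot cancel.\<close>

lemma primeideal_order_ideal:
  assumes "finite E"
  shows "primeideal (order_ideal E D 1 :: ('e, 'k::field) mpoly set) (mpoly_ring E)"
proof (rule primeidealI[OF ideal_order_ideal mpoly_ring_cring])
  have "1 \<notin> (order_ideal E D 1 :: ('e, 'k) mpoly set)"
    by (simp add: order_ideal_def)
  moreover have "(1 :: ('e, 'k) mpoly) \<in> carrier (mpoly_ring E)"
    by simp
  ultimately show "carrier (mpoly_ring E) \<noteq> (order_ideal E D 1 :: ('e, 'k) mpoly set)"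
    by blast
next
  fix p q :: "('e, 'k) mpoly"
  assume pq: "p \<in> carrier (mpoly_ring E)" "q \<in> carrier (mpoly_ring E)"
    and prod: "p \<otimes>\<^bsub>mpoly_ring E\<^esub> q \<in> order_ideal E D 1"
  show "p \<in> order_ideal E D 1 \<or> q \<in> order_ideal E D 1"
  proof (rule ccontr)
    define low where "low r = {m \<in> Poly_Mapping.keys r. partial_degree D m = 0}" for r :: "('e, 'k) mpoly"
    assume "\<not> ?thesis"
    with pq have ne: "low p \<noteq> {}" "low q \<noteq> {}"
      by (auto simp: order_ideal_def low_def Suc_le_eq)
    have fin: "finite (low r)" for r by (simp add: low_def)
    have agree: "Poly_Mapping.lookup a e = Poly_Mapping.lookup b e"
      if "a \<in> low r" "b \<in> low r" "e \<notin> E" "r \<in> carrier (mpoly_ring E)" for a b e r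
    proof -
      have "e \<notin> Poly_Mapping.keys a" "e \<notin> Poly_Mapping.keys b"
        using that by (auto simp: low_def)
      then show ?thesis by (simp add: in_keys_iff)
    qed
    have "\<exists>a\<in>low p. \<exists>b\<in>low q. \<forall>a'\<in>low p. \<forall>b'\<in>low q. a' + b' = a + b \<longrightarrow> a' = a \<and> b' = b"
      by (rule unique_sum_exists[OF \<open>finite E\<close> fin ne(1) fin ne(2)])
        (use agree pq in blast)+
    then obtain a b where ab: "a \<in> low p" "b \<in> low q"
      and uniq: "\<And>a' b'. a' \<in> low p \<Longrightarrow> b' \<in> low q \<Longrightarrow> a' + b' = a + b \<Longrightarrow> a' = a \<and> b' = b"
      by blast
    have deg0: "partial_degree D (a + b) = 0"
      using ab by (simp add: low_def partial_degree_add)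
    have "Poly_Mapping.lookup (p * q) (a + b) = Poly_Mapping.lookup p a * Poly_Mapping.lookup q b"
    proof (rule lookup_mult_unique_sum)
      fix a' b'
      assume *: "a' \<in> Poly_Mapping.keys p" "b' \<in> Poly_Mapping.keys q" "a' + b' = a + b"
      \<comment> \<open>A sum of partial degree 0 has both summands of partial degree 0, so
        monomials outside \<open>low\<close> cannot interfere.\<close>
      then have "a' \<in> low p" "b' \<in> low q"
        using deg0 partial_degree_add[of D a' b'] by (auto simp: low_def)
      with uniq * show "a' = a \<and> b' = b" by blast
    qed
    then have "a + b \<in> Poly_Mapping.keys (p * q)"
      using ab by (simp add: low_def in_keys_iff)
    with prod deg0 show False by (auto simp: order_ideal_def)
  qed
qed

section \<open>Symbolic powers of facet ideals\<close>

lemma sqfree_monom_eq: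
  assumes "finite U"
  shows "(sqfree_monom U :: ('e, 'k::field) mpoly)
    = Poly_Mapping.single (\<Sum>e\<in>U. Poly_Mapping.single e (Suc 0)) 1"
  using assms unfolding sqfree_monom_def
  by (induction U rule: finite_induct) (auto simp: var_def mult_single)

lemma keys_sum_single:
  assumes "finite U"
  shows "Poly_Mapping.keys (\<Sum>e\<in>U. Poly_Mapping.single e (Suc 0)) = U"
  using assms by (induction U rule: finite_induct) (auto simp: keys_add_nat)

lemma partial_degree_sum_single:
  assumes "finite D" "finite U"
  shows "partial_degree D (\<Sum>e\<in>U. Poly_Mapping.single e (Suc 0)) = card (U \<inter> D)"
  using assms(2)
  by (induction U rule: finite_induct)
    (use assms(1) in \<open>auto simp: partial_degree_add partial_degree_single Int_insert_left\<close>)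

text \<open>Primality splits off one variable at a time; the empty product is excluded because a
  prime ideal cannot contain 1.\<close>

lemma sqfree_monom_in_primeideal:
  fixes P :: "('e, 'k::field) mpoly set"
  assumes "primeideal P (mpoly_ring E)" "finite U" "U \<subseteq> E" "sqfree_monom U \<in> P"
  shows "\<exists>e\<in>U. var e \<in> P"
  using assms(2-4)
proof (induction U rule: finite_induct)
  interpret primeideal P "mpoly_ring E" by (rule assms(1))
  case empty
  then have "\<one>\<^bsub>mpoly_ring E\<^esub> \<in> P" by (simp add: sqfree_monom_def)
  then have "P = carrier (mpoly_ring E)" by (rule one_imp_carrier)
  with I_notcarr show ?case by blast
next
  case (insert e U)
  interpret primeideal P "mpoly_ring E" by (rule assms(1))
  have "var e \<in> carrier (mpoly_ring E :: ('e, 'k) mpoly ring)"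
    using insert by (simp add: var_def)
  moreover have "sqfree_monom U \<in> carrier (mpoly_ring E :: ('e, 'k) mpoly ring)"
    using insert by (simp add: sqfree_monom_eq keys_sum_single)
  moreover have "var e \<otimes>\<^bsub>mpoly_ring E\<^esub> sqfree_monom U \<in> P"
    using insert by (simp add: sqfree_monom_def)
  ultimately have "var e \<in> P \<or> sqfree_monom U \<in> P" by (rule I_prime)
  with insert show ?case by auto
qed

lemma sqfree_monom_in_facet_ideal:
  assumes "finite E" "\<B> \<subseteq> Pow E" "B \<in> \<B>"
  shows "(sqfree_monom B :: ('e, 'k::field) mpoly) \<in> facet_ideal E \<B>"
proof -
  interpret cring "mpoly_ring E :: ('e, 'k) mpoly ring" by (rule mpoly_ring_cring)
  have "sqfree_monom ` \<B> \<subseteq> carrier (mpoly_ring E :: ('e, 'k) mpoly ring)"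
  proof
    fix p :: "('e, 'k) mpoly" assume "p \<in> sqfree_monom ` \<B>"
    then obtain U where "U \<in> \<B>" "p = sqfree_monom U" by blast
    moreover from this assms have "finite U" "U \<subseteq> E" by (auto intro: finite_subset)
    ultimately show "p \<in> carrier (mpoly_ring E)"
      by (simp add: sqfree_monom_eq keys_sum_single)
  qed
  from genideal_self[OF this] assms(3) show ?thesis
    unfolding facet_ideal_def by blast
qed

section \<open>Powers of ideals, minimal primes and symbolic powers\<close>

lemma monoid_ideals_set:
  "monoid (ideals_set (mpoly_ring E :: ('e, 'k::field) mpoly ring))"
  by (rule semiring.axioms(2)[OF cring.ideals_set_is_semiring[OF mpoly_ring_cring]])

text \<open>Splitting \<open>s\<close> variables with indices in \<open>G\<close> off the monomial,
  one per induction step, exhibits \<open>s\<close> factors in \<open>P\<close>.\<close>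

lemma single_in_ideal_power:
  fixes P :: "('e, 'k::field) mpoly set"
  assumes "Poly_Mapping.keys m \<subseteq> E" "\<And>e. e \<in> G \<Longrightarrow> var e \<in> P" "s \<le> partial_degree G m"
  shows "Poly_Mapping.single m 1 \<in> P [^]\<^bsub>ideals_set (mpoly_ring E)\<^esub> s"
  using assms(1,3)
proof (induction s arbitrary: m)
  case 0
  then show ?case
    by (simp add: monoid.nat_pow_0[OF monoid_ideals_set]) (simp add: ideals_set_def)
next
  case (Suc s)
  have "partial_degree G m \<noteq> 0" using Suc by simp
  then obtain e where e: "e \<in> G" "Poly_Mapping.lookup m e \<noteq> 0"
    unfolding partial_degree_def by (meson sum.neutral)
  \<comment> \<open>Sums over infinite sets are 0 by convention, so a nonzero partial degree forces
    finiteness.\<close>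
  have "finite G"
    using \<open>partial_degree G m \<noteq> 0\<close> by (metis partial_degree_def sum.infinite)
  \<comment> \<open>The truncated subtraction is exact, since \<open>e\<close> has a nonzero
    exponent in \<open>m\<close>.\<close>
  define m' where "m' = m - Poly_Mapping.single e 1"
  have m: "m = m' + Poly_Mapping.single e 1"
    using e unfolding m'_def
    by (intro poly_mapping_eqI) (auto simp: lookup_add lookup_minus lookup_single when_def)
  have "s \<le> partial_degree G m'"
    using Suc.prems(2) e \<open>finite G\<close>
    unfolding m by (simp add: partial_degree_add partial_degree_single)
  moreover have "Poly_Mapping.keys m' \<subseteq> E"
    using Suc.prems(1) unfolding m by (simp add: keys_add_nat)
  ultimately have "Poly_Mapping.single m' 1 \<in> P [^]\<^bsub>ideals_set (mpoly_ring E)\<^esub> s"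
    by (rule Suc.IH[rotated])
  from ideal_prod.prod[OF this assms(2)[OF e(1)], of "mpoly_ring E"]
  have "Poly_Mapping.single m 1 \<in>
      ideal_prod (mpoly_ring E) (P [^]\<^bsub>ideals_set (mpoly_ring E)\<^esub> s) P"
    by (simp add: var_def mult_single m)
  then show ?case
    by (simp add: monoid.nat_pow_Suc[OF monoid_ideals_set]) (simp add: ideals_set_def)
qed

text \<open>Partial degrees add under products. This turns membership in a power of the prime into
  an inequality on exponents.\<close>

lemma order_ideal_power_subset:
  "order_ideal E D 1 [^]\<^bsub>ideals_set (mpoly_ring E)\<^esub> s
    \<subseteq> (order_ideal E D s :: ('e, 'k::field) mpoly set)"
proof (induction s)
  case 0
  then show ?case
    by (simp add: monoid.nat_pow_0[OF monoid_ideals_set]) (simp add: ideals_set_def)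
next
  case (Suc s)
  have "ideal_prod (mpoly_ring E) (order_ideal E D 1 [^]\<^bsub>ideals_set (mpoly_ring E)\<^esub> s)
      (order_ideal E D 1) \<subseteq> (order_ideal E D (Suc s) :: ('e, 'k) mpoly set)"
  proof
    fix p :: "('e, 'k) mpoly"
    assume "p \<in> ideal_prod (mpoly_ring E)
      (order_ideal E D 1 [^]\<^bsub>ideals_set (mpoly_ring E)\<^esub> s) (order_ideal E D 1)"
    then show "p \<in> order_ideal E D (Suc s)"
    proof (induction rule: ideal_prod.induct)
      case (prod i j)
      then show ?case using Suc.IH order_ideal_mult[of i E D s j 1] by auto
    qed (simp add: order_ideal_add)
  qed
  then show ?case
    by (simp add: monoid.nat_pow_Suc[OF monoid_ideals_set]) (simp add: ideals_set_def)
qed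

text \<open>Every basis meets \<open>E - F\<close>, so the prime contains the facet ideal. For
  minimality, a basis inside \<open>insert e F\<close> forces \<open>var e\<close> into any smaller
  prime \<open>Q\<close>, and these variables generate everything.\<close>

lemma order_ideal_minimal_prime:
  assumes "finite E" "\<B> \<subseteq> Pow E"
    and free: "\<And>B. B \<in> \<B> \<Longrightarrow> \<not> B \<subseteq> F"
    and maximal: "\<And>e. e \<in> E - F \<Longrightarrow> \<exists>B\<in>\<B>. B \<subseteq> insert e F"
  shows "order_ideal E (E - F) 1
    \<in> minimal_primes (mpoly_ring E) (facet_ideal E \<B> :: ('e, 'k::field) mpoly set)"
proof -
  let ?R = "mpoly_ring E :: ('e, 'k) mpoly ring"
  let ?P = "order_ideal E (E - F) 1 :: ('e, 'k) mpoly set"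
  interpret cring ?R by (rule mpoly_ring_cring)
  have fin: "finite B" "B \<subseteq> E" if "B \<in> \<B>" for B
    using that assms(1,2) by (auto intro: finite_subset)
  have "facet_ideal E \<B> \<subseteq> ?P"
    unfolding facet_ideal_def
  proof (rule genideal_minimal[OF ideal_order_ideal], safe)
    fix B assume B: "B \<in> \<B>"
    then have "B \<inter> (E - F) \<noteq> {}" using free fin by blast
    then have "1 \<le> card (B \<inter> (E - F))"
      using \<open>finite E\<close> by (simp add: Suc_le_eq card_gt_0_iff)
    then show "sqfree_monom B \<in> ?P"
      using fin[OF B] \<open>finite E\<close>
      by (simp add: order_ideal_def sqfree_monom_eq keys_sum_single
          partial_degree_sum_single)
  qed
  moreover have "Q = ?P"
    if Q: "primeideal Q ?R" "facet_ideal E \<B> \<subseteq> Q" "Q \<subseteq> ?P" for Q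
  proof
    interpret Q: primeideal Q ?R by (rule Q(1))
    have "var e \<in> Q" if e: "e \<in> E - F" for e
    proof -
      from maximal[OF e] obtain B where B: "B \<in> \<B>" "B \<subseteq> insert e F" by blast
      have "sqfree_monom B \<in> Q"
        using sqfree_monom_in_facet_ideal[OF assms(1,2) B(1)] Q(2) by blast
      then obtain f where f: "f \<in> B" "var f \<in> Q"
        using sqfree_monom_in_primeideal[OF Q(1) fin[OF B(1)]] by blast
      \<comment> \<open>\<open>Q\<close> lies in \<open>?P\<close>, which contains no variable with
        index in \<open>F\<close>; as \<open>f\<close> lies in \<open>insert e F\<close>, it must be
        \<open>e\<close>.\<close>
      then have "(var f :: ('e, 'k) mpoly) \<in> ?P" using Q(3) by blast
      then have "f \<notin> F"
        using \<open>finite E\<close>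
        by (auto simp: order_ideal_def var_def partial_degree_single split: if_splits)
      with f B show ?thesis by blast
    qed
    note var_Q = this
    show "?P \<subseteq> Q"
    proof
      fix p assume p: "p \<in> ?P"
      \<comment> \<open>Each monomial of \<open>p\<close> is divisible by a variable outside
        \<open>F\<close>; summing the terms of \<open>p\<close> then places \<open>p\<close> in
        \<open>Q\<close>.\<close>
      have single_Q: "Poly_Mapping.single m c \<in> Q" if m: "m \<in> Poly_Mapping.keys p" for m c
      proof -
        have "partial_degree (E - F) m \<noteq> 0" using p m by (auto simp: order_ideal_def)
        then obtain e where e: "e \<in> E - F" "Poly_Mapping.lookup m e \<noteq> 0"
          unfolding partial_degree_def by (meson sum.neutral)
        define m' where "m' = m - Poly_Mapping.single e 1"
        have m_eq: "m = Poly_Mapping.single e 1 + m'"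
          using e unfolding m'_def
          by (intro poly_mapping_eqI) (auto simp: lookup_add lookup_minus lookup_single when_def)
        have "Poly_Mapping.keys m \<subseteq> E" using p m by (auto simp: order_ideal_def)
        then have "Poly_Mapping.single m' c \<in> carrier ?R"
          unfolding m_eq by (simp add: keys_add_nat)
        from Q.I_r_closed[OF var_Q[OF e(1)] this] show ?thesis
          by (simp add: var_def mult_single m_eq)
      qed
      have "(\<Sum>m\<in>K. Poly_Mapping.single m (Poly_Mapping.lookup p m)) \<in> Q"
        if "finite K" "K \<subseteq> Poly_Mapping.keys p" for K
        using that
      proof (induction K rule: finite_induct)
        case empty
        then show ?case using Q.zero_closed by simp
      next
        case (insert x K)
        then show ?case using Q.a_closed[OF single_Q, of x] by simp
      qed
      from this[of "Poly_Mapping.keys p"] show "p \<in> Q"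
        by (simp add: sum_single_lookup)
    qed
  qed (rule Q(3))
  ultimately show ?thesis
    using primeideal_order_ideal[OF assms(1), of "E - F"] unfolding minimal_primes_def by blast
qed

text \<open>The minimal primes need no classification: for any prime \<open>P\<close> over the facet
  ideal, the indices of variables outside \<open>P\<close> form a basis-free set, so
  \<open>deg\<close> counts exponents of variables in \<open>P\<close>.\<close>

lemma single_in_symbolic_power:
  assumes "finite E" "\<B> \<subseteq> Pow E" "Poly_Mapping.keys m \<subseteq> E"
    and deg: "\<And>F. F \<subseteq> E \<Longrightarrow> (\<And>B. B \<in> \<B> \<Longrightarrow> \<not> B \<subseteq> F) \<Longrightarrow> s \<le> partial_degree (E - F) m"
  shows "Poly_Mapping.single m 1
    \<in> symbolic_power (mpoly_ring E) (facet_ideal E \<B> :: ('e, 'k::field) mpoly set) s"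
  unfolding symbolic_power_def
proof (intro IntI INT_I)
  show "Poly_Mapping.single m 1 \<in> carrier (mpoly_ring E :: ('e, 'k) mpoly ring)"
    using assms(3) by simp
  fix P assume "P \<in> minimal_primes (mpoly_ring E) (facet_ideal E \<B> :: ('e, 'k) mpoly set)"
  then have P: "primeideal P (mpoly_ring E)" "facet_ideal E \<B> \<subseteq> P"
    by (auto simp: minimal_primes_def)
  have "s \<le> partial_degree (E - {e \<in> E. var e \<notin> P}) m"
  proof (rule deg)
    fix B assume B: "B \<in> \<B>"
    then have "sqfree_monom B \<in> P"
      using sqfree_monom_in_facet_ideal[OF assms(1,2) B] P(2) by blast
    moreover have "finite B" "B \<subseteq> E" using B assms(1,2) by (auto intro: finite_subset)
    ultimately show "\<not> B \<subseteq> {e \<in> E. var e \<notin> P}"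
      using sqfree_monom_in_primeideal[OF P(1)] by blast
  qed auto
  with assms(3) show "Poly_Mapping.single m 1 \<in> P [^]\<^bsub>ideals_set (mpoly_ring E)\<^esub> s"
    by (intro single_in_ideal_power) auto
qed

text \<open>Enlarging \<open>F\<close> to a maximal basis-free set yields a minimal prime; returning
  to \<open>F\<close> only enlarges the complement.\<close>

lemma symbolic_power_partial_degree:
  assumes "finite E" "\<B> \<subseteq> Pow E" "F \<subseteq> E" "\<And>B. B \<in> \<B> \<Longrightarrow> \<not> B \<subseteq> F"
    and p: "p \<in> symbolic_power (mpoly_ring E) (facet_ideal E \<B> :: ('e, 'k::field) mpoly set) s"
    and m: "m \<in> Poly_Mapping.keys p"
  shows "s \<le> partial_degree (E - F) m"
proof -
  let ?free = "{F. F \<subseteq> E \<and> (\<forall>B\<in>\<B>. \<not> B \<subseteq> F)}"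
  have "finite ?free" using \<open>finite E\<close> by simp
  then obtain F' where F': "F' \<in> ?free" "F \<subseteq> F'" and max: "\<And>G. G \<in> ?free \<Longrightarrow> F' \<subseteq> G \<Longrightarrow> F' = G"
    using finite_has_maximal2[of ?free F] assms(3,4) by auto
  have "order_ideal E (E - F') 1
    \<in> minimal_primes (mpoly_ring E) (facet_ideal E \<B> :: ('e, 'k) mpoly set)"
  proof (rule order_ideal_minimal_prime[OF assms(1,2)])
    fix e assume e: "e \<in> E - F'"
    then show "\<exists>B\<in>\<B>. B \<subseteq> insert e F'"
      using max[of "insert e F'"] F'(1) by auto
  qed (use F' in auto)
  then have "p \<in> order_ideal E (E - F') s"
    using p order_ideal_power_subset unfolding symbolic_power_def by blast
  then have "s \<le> partial_degree (E - F') m" using m by (simp add: order_ideal_def)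
  also have "\<dots> \<le> partial_degree (E - F) m"
    unfolding partial_degree_def using F'(2) \<open>finite E\<close> by (intro sum_mono2) auto
  finally show ?thesis .
qed

section \<open>The linear programme of an almost-uniform matroid\<close>

text \<open>Discarding a largest value never raises the average, so this is repeated until
  \<open>j\<close> elements remain. The product form also covers \<open>j = 0\<close>.\<close>

lemma small_sum_subset:
  fixes f :: "'a \<Rightarrow> real"
  assumes "finite D" "j \<le> card D"
  shows "\<exists>H\<subseteq>D. card H = j \<and> real (card D) * sum f H \<le> real j * sum f D"
  using assms
proof (induction "card D - j" arbitrary: D)
  case 0
  then show ?case by (intro exI[of _ D]) auto
next
  case (Suc i)
  then have "D \<noteq> {}" by auto
  then obtain x where x: "x \<in> D" "\<And>y. y \<in> D \<Longrightarrow> f y \<le> f x"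
    using finite_maximizer[of D f] Suc.prems(1) by blast
  define D' where "D' = D - {x}"
  have D': "finite D'" "card D' = card D - 1" "j \<le> card D'"
    using Suc x by (auto simp: D'_def)
  have "i = card D' - j" using Suc.hyps(2) D' by simp
  from Suc.hyps(1)[OF this D'(1,3)] obtain H
    where H: "H \<subseteq> D'" "card H = j" "real (card D') * sum f H \<le> real j * sum f D'" by blast
  have "sum f H \<le> real j * f x"
    using sum_bounded_above[of H f "f x"] H x by (auto simp: D'_def)
  moreover have "sum f D = f x + sum f D'"
    unfolding D'_def using x Suc.prems by (simp add: sum.remove)
  moreover have "real (card D) = real (card D') + 1"
    using D'(2) Suc.hyps(2) by linarith
  ultimately have "real (card D) * sum f H \<le> real j * sum f D"
    using H(3) by (simp add: algebra_simps)
  then show ?case using H by (intro exI[of _ H]) (auto simp: D'_def)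
qed

section \<open>The optimal value, with its lower bound and an optimal point\<close>

definition au_value :: "nat \<Rightarrow> nat \<Rightarrow> real" where
  "au_value n k =
     min ((real n - 1) / (real n - real k)) ((real n + 1) / (real n - real k + 1))"

text \<open>Clearing the denominators, positive since \<open>k < n\<close>, turns the comparison of
  the two fractions into \<open>2 * k\<close> against \<open>n + 1\<close>.\<close>

lemma au_value_small:
  assumes "k < n" "2 * k \<le> n + 1"
  shows "au_value n k = (real n - 1) / (real n - real k)"
proof -
  have "(real n - 1) / (real n - real k) \<le> (real n + 1) / (real n - real k + 1)"
    using assms by (simp add: field_simps)
  then show ?thesis by (simp add: au_value_def)
qed

lemma au_value_large:
  assumes "k < n" "2 * k \<ge> n + 1"
  shows "au_value n k = (real n + 1) / (real n - real k + 1)"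
proof -
  have "(real n - 1) / (real n - real k) \<ge> (real n + 1) / (real n - real k + 1)"
    using assms by (simp add: field_simps)
  then show ?thesis by (simp add: au_value_def)
qed

text \<open>Weak duality: a nonnegative combination of the constraint on \<open>E - C\<close> and
  the averaged constraints has equal weight on all of \<open>E\<close>.\<close>

lemma au_lower_bound:
  fixes f :: "'e \<Rightarrow> real"
  assumes E: "finite E" "card E = n" and C: "C \<subseteq> E" "card C = k" and k: "1 \<le> k" "k < n"
    and compl: "s \<le> sum f (E - C)"
    and big: "\<And>G. G \<subseteq> E \<Longrightarrow> card G = n - k + 1 \<Longrightarrow> s \<le> sum f G"
  shows "s * au_value n k \<le> sum f E"
proof -
  define d where "d = n - k"
  have d: "d \<ge> 1" "n = k + d" using k by (auto simp: d_def)
  have fin: "finite C" "finite (E - C)" using E C finite_subset by auto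
  have card_compl: "card (E - C) = d"
    using E C fin by (simp add: card_Diff_subset d_def)
  have split: "sum f E = sum f C + sum f (E - C)"
    using E C by (metis sum.subset_diff add.commute)
  show ?thesis
  proof (cases "2 * k \<ge> n + 1")
    case True
    then have "d + 1 \<le> card C" using C d by simp
    then obtain H where H: "H \<subseteq> C" "card H = d + 1"
      "real (card C) * sum f H \<le> real (d + 1) * sum f C"
      using small_sum_subset[OF fin(1)] by blast
    have "s \<le> sum f H" using H C by (intro big) (auto simp: d_def)
    then have "real k * s \<le> real k * sum f H" by (simp add: mult_left_mono)
    then have "real k * s \<le> real (d + 1) * sum f C" using H C by simp
    moreover have "real (d + 1) * s \<le> real (d + 1) * sum f (E - C)"
      using compl by (intro mult_left_mono) auto
    ultimately have "s * (real n + 1) \<le> sum f E * real (d + 1)"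
      using d(2) by (simp add: split algebra_simps)
    moreover have "au_value n k = (real n + 1) / real (d + 1)"
      using au_value_large[OF k(2) True] d by simp
    ultimately show ?thesis by (simp add: pos_divide_le_eq)
  next
    case False
    \<comment> \<open>This many elements complete \<open>C\<close> to size \<open>d + 1\<close>;
      here \<open>k\<close> is at most \<open>d\<close>, so the subtraction is exact.\<close>
    define j where "j = d + 1 - k"
    have j: "real j = real d + 1 - real k" "j \<le> card (E - C)"
      using False d k card_compl by (auto simp: j_def)
    then obtain H where H: "H \<subseteq> E - C" "card H = j"
      "real d * sum f H \<le> real j * sum f (E - C)"
      using small_sum_subset[OF fin(2) j(2), of f] card_compl by auto
    have disj: "C \<inter> H = {}" "finite H" using H fin finite_subset by blast+
    have "card (C \<union> H) = n - k + 1"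
      using disj fin C H False d by (simp add: card_Un_disjoint j_def)
    then have "s \<le> sum f (C \<union> H)" using C H by (intro big) auto
    also have "\<dots> = sum f C + sum f H"
      using disj fin by (intro sum.union_disjoint) auto
    finally have "real d * s \<le> real d * sum f C + real d * sum f H"
      by (metis distrib_left mult_left_mono of_nat_0_le_iff)
    with H(3) have "real d * s \<le> real d * sum f C + real j * sum f (E - C)" by linarith
    \<comment> \<open>Taking the constraint on \<open>E - C\<close> another \<open>k - 1\<close>
      times raises the weight there from \<open>j\<close> to \<open>d\<close>, the weight on
      \<open>C\<close>.\<close>
    moreover have "(real k - 1) * s \<le> (real k - 1) * sum f (E - C)"
      using compl k by (intro mult_left_mono) auto
    ultimately have "s * (real n - 1) \<le> sum f E * real d"
      using d(2) by (simp add: split j algebra_simps)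
    moreover have "au_value n k = (real n - 1) / real d"
      using au_value_small[OF k(2)] False d by simp
    ultimately show ?thesis using d by (simp add: pos_divide_le_eq)
  qed
qed

lemma au_optimum_exists:
  assumes E: "finite E" "card E = n" and C: "C \<subseteq> E" "card C = k" and k: "1 \<le> k" "k < n"
  obtains x :: "'e \<Rightarrow> real" where "\<And>e. 0 \<le> x e" "sum x E = au_value n k" "1 \<le> sum x (E - C)"
    "\<And>G. G \<subseteq> E \<Longrightarrow> n - k + 1 \<le> card G \<Longrightarrow> 1 \<le> sum x G"
proof -
  define d where "d = n - k"
  have d: "d \<ge> 1" "n = k + d" using k by (auto simp: d_def)
  have fin: "finite C" "finite (E - C)" using E C finite_subset by auto
  have card_compl: "card (E - C) = d"
    using E C fin by (simp add: card_Diff_subset d_def)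
  \<comment> \<open>The value \<open>b\<close> makes the constraint on \<open>E - C\<close> tight.
    Then \<open>a\<close> makes tight either the sets of size \<open>d + 1\<close> inside
    \<open>C\<close>, or those containing \<open>C\<close>, where
    \<open>k * a + (d + 1 - k) * b = 1\<close>.\<close>
  define a where "a = (if 2 * k \<ge> n + 1 then 1 / (real d + 1) else (real k - 1) / (real k * real d))"
  define b where "b = 1 / real d"
  define x where "x e = (if e \<in> C then a else b)" for e
  have sum_x: "sum x G = real (card (G \<inter> C)) * a + real (card (G - C)) * b" if "G \<subseteq> E" for G
  proof -
    have "finite G" using that E finite_subset by auto
    have "sum x G = sum x (G \<inter> C) + sum x (G - C)"
      using \<open>finite G\<close> by (simp add: sum.Int_Diff)
    also have "sum x (G \<inter> C) = (\<Sum>e\<in>G \<inter> C. a)" by (rule sum.cong) (auto simp: x_def)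
    also have "sum x (G - C) = (\<Sum>e\<in>G - C. b)" by (rule sum.cong) (auto simp: x_def)
    finally show ?thesis by simp
  qed
  have ab: "0 \<le> a" "0 \<le> b" using k by (auto simp: a_def b_def)
  have compl: "real (card (E - C)) * b = 1" using card_compl d by (simp add: b_def)
  have total: "sum x E = real k * a + 1"
    using sum_x[of E] compl C by (simp add: Int_absorb1)
  show ?thesis
  proof
    show "0 \<le> x e" for e using ab by (simp add: x_def)
    show "1 \<le> sum x (E - C)" using sum_x[of "E - C"] compl by (simp add: Int_commute)
    show "sum x E = au_value n k"
    proof (cases "2 * k \<ge> n + 1")
      case True
      then have "sum x E = real k * (1 / (real d + 1)) + 1" by (simp add: total a_def)
      also have "\<dots> = (real n + 1) / (real d + 1)" using d by (simp add: field_simps)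
      finally show ?thesis using au_value_large[OF k(2) True] d by simp
    next
      case False
      then have "sum x E = real k * ((real k - 1) / (real k * real d)) + 1"
        by (simp add: total a_def)
      also have "\<dots> = (real n - 1) / real d" using d k by (simp add: field_simps)
      finally show ?thesis using au_value_small[OF k(2)] False d by simp
    qed
    fix G assume G: "G \<subseteq> E" "n - k + 1 \<le> card G"
    have "finite G" using G E finite_subset by auto
    then have card_G: "real d + 1 \<le> real (card (G \<inter> C)) + real (card (G - C))"
      using G(2) card_Int_Diff[of G C] unfolding d_def[symmetric] by simp
    have card_GC: "real (card (G \<inter> C)) \<le> real k"
      using C fin card_mono[of C "G \<inter> C"] by simp
    show "1 \<le> sum x G"
    proof (cases "2 * k \<ge> n + 1")
      case True
      have "a \<le> b" using True d by (simp add: a_def b_def field_simps)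
      have "1 = (real d + 1) * a" using True by (simp add: a_def add_eq_0_iff)
      also have "\<dots> \<le> (real (card (G \<inter> C)) + real (card (G - C))) * a"
        using card_G ab by (intro mult_right_mono) auto
      also have "\<dots> \<le> sum x G"
        using \<open>a \<le> b\<close> by (simp add: sum_x[OF G(1)] distrib_right mult_left_mono)
      finally show ?thesis .
    next
      case False
      \<comment> \<open>An element of \<open>C\<close> weighs \<open>b / k\<close> less than one
        outside. At most \<open>k\<close> of them occur, so the total loss is at most
        \<open>b\<close>, leaving \<open>d * b = 1\<close>.\<close>
      have a_eq: "a = b - b / real k" using False d k by (simp add: a_def b_def field_simps)
      have "(real d + 1) * b \<le> (real (card (G \<inter> C)) + real (card (G - C))) * b"
        using card_G ab by (intro mult_right_mono) auto
      moreover have "real (card (G \<inter> C)) * (b / real k) \<le> real k * (b / real k)"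
        using card_GC ab by (intro mult_right_mono) auto
      moreover have "real k * (b / real k) = b" using k by simp
      moreover have "real d * b = 1" using d by (simp add: b_def)
      ultimately show ?thesis
        by (simp add: sum_x[OF G(1)] a_eq algebra_simps)
    qed
  qed
qed

section \<open>The Waldschmidt constant\<close>

lemma monom_degree_eq_partial_degree:
  "finite E \<Longrightarrow> Poly_Mapping.keys m \<subseteq> E \<Longrightarrow> monom_degree m = partial_degree E m"
  unfolding monom_degree_def partial_degree_def
  by (rule sum.mono_neutral_left) (auto simp: in_keys_iff)

text \<open>The given monomial ensures that \<open>LEAST\<close> is attained; any monomial of a
  polynomial attaining it has degree \<open>alpha J\<close> and transfers the bound
  \<open>c\<close>.\<close>

lemma alpha_between:
  fixes J :: "('e, 'k::field) mpoly set"
  assumes "Poly_Mapping.single m 1 \<in> J"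
    and "\<And>p m'. p \<in> J \<Longrightarrow> m' \<in> Poly_Mapping.keys p \<Longrightarrow> c \<le> real (monom_degree m')"
  shows "c \<le> real (alpha J)" "alpha J \<le> monom_degree m"
proof -
  have ex: "\<exists>p\<in>J. p \<noteq> 0 \<and> homogeneous (monom_degree m) p"
    using assms(1) by (intro bexI[of _ "Poly_Mapping.single m 1"])
      (auto simp: homogeneous_def simp flip: keys_eq_empty)
  then show "alpha J \<le> monom_degree m"
    unfolding alpha_def by (rule Least_le)
  obtain p where p: "p \<in> J" "p \<noteq> 0" "homogeneous (alpha J) p"
    using LeastI[where P = "\<lambda>d. \<exists>p\<in>J. p \<noteq> 0 \<and> homogeneous d p", OF ex]
    unfolding alpha_def by blast
  then obtain m' where "m' \<in> Poly_Mapping.keys p"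
    by (metis keys_eq_empty ex_in_conv)
  with p assms(2) show "c \<le> real (alpha J)"
    by (metis homogeneous_def)
qed

lemma almost_uniform_alpha_bounds:
  fixes I :: "('e, 'k::field) mpoly set"
  assumes E: "finite E" "card E = n" and "k < n" and "almost_uniform E k \<B>"
    and I: "I = facet_ideal E \<B>"
  shows "real s * au_value n k \<le> real (alpha (symbolic_power (mpoly_ring E) I s))"
    and "real (alpha (symbolic_power (mpoly_ring E) I s)) \<le> real s * au_value n k + real n"
proof -
  from assms(4) obtain C where C: "C \<subseteq> E" "card C = k"
    and \<B>: "\<B> = {B. B \<subseteq> E \<and> card B = k} - {C}" and "\<B> \<noteq> {}"
    unfolding almost_uniform_def matroid_bases_def by blast
  have "\<B> \<subseteq> Pow E" using \<B> by auto
  have fin: "finite F" if "F \<subseteq> E" for F by (rule finite_subset[OF that E(1)])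
  \<comment> \<open>For \<open>k = 0\<close> the only candidate basis is the empty set, which is the
    omitted \<open>C\<close>; no basis would remain.\<close>
  have "1 \<le> k"
  proof (rule ccontr)
    assume "\<not> 1 \<le> k"
    then have "k = 0" by simp
    then have "B = {}" if "B \<subseteq> E" "card B = k" for B using that fin[of B] by simp
    with C have "\<B> = {}" unfolding \<B> by blast
    with \<open>\<B> \<noteq> {}\<close> show False by blast
  qed
  have free_C: "\<not> B \<subseteq> C" if "B \<in> \<B>" for B
    using that \<B> C fin card_subset_eq[of C B] by auto
  have free_small: "\<not> B \<subseteq> F" if "B \<in> \<B>" "F \<subseteq> E" "card F < k" for B F
    using that \<B> fin card_mono[of F B] by auto
  have free_cases: "F = C \<or> card F < k" if F: "F \<subseteq> E" "\<And>B. B \<in> \<B> \<Longrightarrow> \<not> B \<subseteq> F" for F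
  proof (rule ccontr)
    assume neg: "\<not> ?thesis"
    have "\<exists>B\<subseteq>F. card B = k \<and> B \<noteq> C"
    proof (cases "C \<subseteq> F")
      case True
      with neg obtain e where e: "e \<in> F" "e \<notin> C" by blast
      have "k - 1 \<le> card C" using C by simp
      \<comment> \<open>Exchanging one element of \<open>C\<close> for \<open>e\<close> gives a
        \<open>k\<close>-subset of \<open>F\<close> other than \<open>C\<close>, hence a
        basis.\<close>
      then obtain C' where C': "C' \<subseteq> C" "card C' = k - 1" "finite C'"
        by (rule obtain_subset_with_card_n)
      then have "e \<notin> C'" using e by blast
      with C' have "insert e C' \<subseteq> F" "card (insert e C') = k" "insert e C' \<noteq> C"
        using e True \<open>1 \<le> k\<close> by auto
      then show ?thesis by blast
    next
      case False
      have "k \<le> card F" using neg by simp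
      then obtain B where "B \<subseteq> F" "card B = k" by (rule obtain_subset_with_card_n)
      with False show ?thesis by blast
    qed
    then obtain B where "B \<subseteq> F" "card B = k" "B \<noteq> C" by blast
    with F \<B> show False by blast
  qed
  obtain x :: "'e \<Rightarrow> real" where x: "\<And>e. 0 \<le> x e" "sum x E = au_value n k" "1 \<le> sum x (E - C)"
    "\<And>G. G \<subseteq> E \<Longrightarrow> n - k + 1 \<le> card G \<Longrightarrow> 1 \<le> sum x G"
    using au_optimum_exists[OF E C \<open>1 \<le> k\<close> \<open>k < n\<close>] by blast
  \<comment> \<open>The rounded optimum scaled by \<open>s\<close>; the value 0 off \<open>E\<close>
    keeps the support finite and inside \<open>E\<close>.\<close>
  define g where "g e = (if e \<in> E then nat \<lceil>real s * x e\<rceil> else 0)" for e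
  define m where "m = Poly_Mapping.Abs_poly_mapping g"
  have "finite {e. g e \<noteq> 0}"
    by (rule finite_subset[OF _ E(1)]) (auto simp: g_def)
  then have lookup_m: "Poly_Mapping.lookup m = g"
    by (simp add: m_def)
  have keys_m: "Poly_Mapping.keys m \<subseteq> E"
    by (auto simp: in_keys_iff lookup_m g_def split: if_splits)
  have g_ge: "real s * x e \<le> real (g e)" if "e \<in> E" for e
    using that by (simp add: g_def real_nat_ceiling_ge)
  have g_le: "real (g e) \<le> real s * x e + 1" if "e \<in> E" for e
  proof -
    have "0 \<le> real s * x e" using x(1) by simp
    then have "real (g e) = of_int \<lceil>real s * x e\<rceil>" using that by (simp add: g_def)
    then show ?thesis by linarith
  qed
  have constraint: "s \<le> partial_degree G m" if "G \<subseteq> E" "1 \<le> sum x G" for G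
  proof -
    have "real s * 1 \<le> real s * sum x G" using that(2) by (rule mult_left_mono) simp
    also have "\<dots> = (\<Sum>e\<in>G. real s * x e)" by (rule sum_distrib_left)
    also have "\<dots> \<le> (\<Sum>e\<in>G. real (g e))" using that(1) by (intro sum_mono g_ge) auto
    also have "\<dots> = real (partial_degree G m)" by (simp add: partial_degree_def lookup_m)
    finally show ?thesis by simp
  qed
  have single_m: "Poly_Mapping.single m 1 \<in> symbolic_power (mpoly_ring E) I s"
    unfolding I
  proof (rule single_in_symbolic_power[OF E(1) \<open>\<B> \<subseteq> Pow E\<close> keys_m])
    fix F assume F: "F \<subseteq> E" "\<And>B. B \<in> \<B> \<Longrightarrow> \<not> B \<subseteq> F"
    show "s \<le> partial_degree (E - F) m"
    proof (rule constraint)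
      from free_cases[OF F] consider "F = C" | "card F < k" by blast
      then show "1 \<le> sum x (E - F)"
      proof cases
        case 1
        with x(3) show ?thesis by simp
      next
        case 2
        then have "n - k + 1 \<le> card (E - F)"
          using E F(1) fin \<open>k < n\<close> by (simp add: card_Diff_subset)
        then show ?thesis by (intro x(4)) auto
      qed
    qed auto
  qed
  have lower: "real s * au_value n k \<le> real (monom_degree m')"
    if p: "p \<in> symbolic_power (mpoly_ring E) I s" and m': "m' \<in> Poly_Mapping.keys p" for p m'
  proof -
    have "p \<in> carrier (mpoly_ring E)" using p unfolding symbolic_power_def by blast
    with m' have deg: "monom_degree m' = partial_degree E m'"
      using E by (intro monom_degree_eq_partial_degree) auto
    define f where "f e = real (Poly_Mapping.lookup m' e)" for e
    have f: "real (partial_degree G m') = sum f G" for G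
      by (simp add: partial_degree_def f_def)
    note bound = symbolic_power_partial_degree[OF E(1) \<open>\<B> \<subseteq> Pow E\<close> _ _ p[unfolded I] m']
    have "real s * au_value n k \<le> sum f E"
    proof (rule au_lower_bound[OF E C \<open>1 \<le> k\<close> \<open>k < n\<close>])
      show "real s \<le> sum f (E - C)"
        using bound[OF C(1) free_C] by (simp flip: f)
      fix G assume G: "G \<subseteq> E" "card G = n - k + 1"
      \<comment> \<open>The complement of a set of size \<open>n - k + 1\<close> has
        \<open>k - 1\<close> elements, too few to contain a basis.\<close>
      then have "card (E - G) < k"
        using E fin \<open>k < n\<close> \<open>1 \<le> k\<close> by (simp add: card_Diff_subset)
      then have "s \<le> partial_degree (E - (E - G)) m'"
        using free_small by (intro bound) auto
      also have "E - (E - G) = G" using G by blast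
      finally show "real s \<le> sum f G" by (simp flip: f)
    qed
    then show ?thesis by (simp add: deg f)
  qed
  note alpha_bounds = alpha_between[OF single_m lower]
  show "real s * au_value n k \<le> real (alpha (symbolic_power (mpoly_ring E) I s))"
    by (rule alpha_bounds(1))
  have "real (alpha (symbolic_power (mpoly_ring E) I s)) \<le> real (monom_degree m)"
    using alpha_bounds(2) by simp
  also have "\<dots> = (\<Sum>e\<in>E. real (g e))"
    using monom_degree_eq_partial_degree[OF E(1) keys_m]
    by (simp add: partial_degree_def lookup_m)
  also have "\<dots> \<le> (\<Sum>e\<in>E. real s * x e + 1)" by (intro sum_mono g_le)
  also have "\<dots> = real s * au_value n k + real n"
    using E x(2) by (simp add: sum.distrib flip: sum_distrib_left)
  finally show "real (alpha (symbolic_power (mpoly_ring E) I s)) \<le> real s * au_value n k + real n" .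
qed

text \<open>Convergence is asserted separately because \<open>lim\<close> alone does not express
  that the limit exists.\<close>

theorem proposition5p5:
  fixes E :: "'e set" and \<B> :: "'e set set" and k n :: nat
    and I :: "('e, 'k::field) mpoly set"
  assumes "finite E" and "card E = n" and "k < n"
    and "almost_uniform E k \<B>"
    and "I = facet_ideal E \<B>"
  shows "convergent (waldschmidt_seq E I)
    \<and> waldschmidt E I =
        min ((real n - 1) / (real n - real k)) ((real n + 1) / (real n - real k + 1))
    \<and> (2 * k \<le> n + 1 \<longrightarrow> waldschmidt E I = (real n - 1) / (real n - real k))
    \<and> (2 * k \<ge> n + 1 \<longrightarrow> waldschmidt E I = (real n + 1) / (real n - real k + 1))"
proof -
  note bounds = almost_uniform_alpha_bounds[OF assms]
  have "waldschmidt_seq E I \<longlonglongrightarrow> au_value n k"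
  proof (rule tendsto_sandwich)
    \<comment> \<open>Dividing the bounds on \<open>alpha\<close> by \<open>s\<close> requires
      positive \<open>s\<close>, hence the restriction to large indices.\<close>
    show "\<forall>\<^sub>F s in sequentially. au_value n k \<le> waldschmidt_seq E I s"
      using eventually_gt_at_top[of "0::nat"]
      by eventually_elim
        (use bounds(1) in \<open>simp add: waldschmidt_seq_def pos_le_divide_eq mult.commute\<close>)
    show "\<forall>\<^sub>F s in sequentially. waldschmidt_seq E I s \<le> au_value n k + real n / real s"
      using eventually_gt_at_top[of "0::nat"]
      by eventually_elim
        (use bounds(2) in \<open>simp add: waldschmidt_seq_def pos_divide_le_eq distrib_left mult.commute\<close>)
    have "(\<lambda>s. au_value n k + real n / real s) \<longlonglongrightarrow> au_value n k + 0"
      by (intro tendsto_add tendsto_const lim_const_over_n)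
    then show "(\<lambda>s. au_value n k + real n / real s) \<longlonglongrightarrow> au_value n k" by simp
  qed simp
  then have "convergent (waldschmidt_seq E I)" "waldschmidt E I = au_value n k"
    unfolding waldschmidt_def by (auto simp: convergent_def limI)
  then show ?thesis
    using au_value_small[OF \<open>k < n\<close>] au_value_large[OF \<open>k < n\<close>] by (simp add: au_value_def)
qed

end
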